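(* For all integers $m\geq 2$ and $k,d\geq 1$, the graph $K_m^{\square k}$ has a distance-$d$ dominating set $C$ satisfying $$|C| = m^{\,k-d\lfloor \log_m(k/d+1)\rfloor} < \frac{d^d\, m^{k+d}}{(k+d)^d}.$$
   Context: The Hamming graph $K_m^{\square k}$ has as its vertices the words of length $k$ over the alphabet $[m]=\{1,\ldots,m\}$ (i.e. the elements of $[m]^k$), and two vertices are adjacent when they differ in exactly one coordinate. A set $C$ of vertices of a graph is a distance-$d$ dominating set if every vertex of the graph is at (graph) distance at most $d$ from a vertex of $C$; in $K_m^{\square k}$ the graph distance is the number of coordinates in which two words differ. *)

theory Defs
  imports Complex_Main "Graph_Theory.Pair_Digraph" "Graph_Theory.Shortest_Path"
begin

definition words :: "nat \<Rightarrow> nat \<Rightarrow> nat list set" where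
  "words m k = {w. length w = k \<and> set w \<subseteq> {1..m}}"

text \<open>An undirected graph is rendered, as usual in this library, by its symmetric digraph.\<close>

definition hamming_graph :: "nat \<Rightarrow> nat \<Rightarrow> nat list pair_pre_digraph" where
  "hamming_graph m k =
    \<lparr> pverts = words m k,
      parcs = {(u, v). u \<in> words m k \<and> v \<in> words m k \<and> card {i. i < k \<and> u ! i \<noteq> v ! i} = 1} \<rparr>"

text \<open>The graph distance is the shortest-path weight for unit arc weights; it is
  infinite if there is no walk between the two vertices.\<close>

definition graph_dist :: "('a, 'b) pre_digraph \<Rightarrow> 'a \<Rightarrow> 'a \<Rightarrow> ereal" where
  "graph_dist G u v = wf_digraph.\<mu> G (\<lambda>_. 1) u v"

definition distance_dominating_set :: "('a, 'b) pre_digraph \<Rightarrow> nat \<Rightarrow> 'a set \<Rightarrow> bool" where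
  "distance_dominating_set G d C \<longleftrightarrow>
    C \<subseteq> verts G \<and> (\<forall>v\<in>verts G. \<exists>c\<in>C. graph_dist G v c \<le> ereal (real d))"

lemma finite_words: "finite (words m k)"
proof -
  have "words m k = {w. set w \<subseteq> {1..m} \<and> length w = k}"
    by (auto simp: words_def)
  then show ?thesis
    by (simp add: finite_lists_length_eq)
qed

lemma pair_graph_hamming_graph: "pair_graph (hamming_graph m k)"
proof
  have "parcs (hamming_graph m k) \<subseteq> words m k \<times> words m k"
    by (auto simp: hamming_graph_def)
  then show "finite (parcs (hamming_graph m k))"
    by (rule finite_subset) (simp add: finite_words)
  show "symmetric (with_proj (hamming_graph m k))"
    unfolding symmetric_def by (auto simp: sym_def hamming_graph_def eq_commute)
qed (auto simp: hamming_graph_def finite_words)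

end

theory Submission
  imports Defs
begin

text \<open>Let \<open>s = \<lfloor>log\<^sub>m (k/d + 1)\<rfloor>\<close>, so that \<open>d (m\<^sup>s - 1) \<le> k\<close>. Among the \<open>k\<close> coordinates choose \<open>d\<close>
  disjoint blocks, each of them indexed by the nonzero vectors of \<open>(\<int>/m)\<^sup>s\<close>. As for Hamming codes,
  the syndrome of a word in a block is the sum of its letters times the indexing vectors. Adding
  \<open>1\<close> to a single letter changes the syndrome of its block by an arbitrary prescribed nonzero vector,
  so \<open>d\<close> changes suffice to reach any prescribed syndrome: every fibre of the syndrome map is a
  distance-\<open>d\<close> dominating set. By pigeonhole one of the \<open>m\<^sup>d\<^sup>s\<close> fibres has at most \<open>m\<^sup>k\<^sup>-\<^sup>d\<^sup>s\<close> elements.\<close>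

section \<open>Hamming distance as a bound on the graph distance\<close>

definition differing :: "'a list \<Rightarrow> 'a list \<Rightarrow> nat \<Rightarrow> nat set" where
  "differing u v k = {i. i < k \<and> u ! i \<noteq> v ! i}"

lemma finite_differing [simp]: "finite (differing u v k)"
  by (simp add: differing_def)

text \<open>Correct the differing coordinates of \<open>u\<close> one at a time: each correction is
  an arc and lowers the number of differences by one.\<close>

lemma awalk_hamming_graph:
  assumes "u \<in> words m k" "v \<in> words m k"
  shows "\<exists>p. pre_digraph.awalk (with_proj (hamming_graph m k)) u p v \<and>
    length p = card (differing u v k)"
  using assms
proof (induction "card (differing u v k)" arbitrary: u)
  case 0
  interpret pair_graph "hamming_graph m k" by (rule pair_graph_hamming_graph)
  from 0 have "u = v"
    by (intro nth_equalityI) (auto simp: words_def differing_def)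
  then show ?case
    using 0 by (intro exI[of _ "[]"]) (simp add: awalk_Nil_iff, simp add: hamming_graph_def)
next
  case (Suc n)
  interpret pair_graph "hamming_graph m k" by (rule pair_graph_hamming_graph)
  from Suc.hyps(2) obtain i where i: "i \<in> differing u v k"
    by (metis card.empty ex_in_conv nat.distinct(1))
  define u' where "u' = u[i := v ! i]"
  have len: "length u = k" "length v = k" and ik: "i < k"
    using Suc.prems i by (auto simp: words_def differing_def)
  have "v ! i \<in> {1..m}"
    using Suc.prems(2) ik nth_mem[of i v] by (auto simp: words_def simp del: nth_mem)
  then have u': "u' \<in> words m k"
    using Suc.prems(1) set_update_subset_insert[of u i "v ! i"] by (auto simp: words_def u'_def)
  have "differing u' v k = differing u v k - {i}"
    using len ik by (auto simp: differing_def u'_def nth_list_update)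
  then have n: "n = card (differing u' v k)"
    using Suc.hyps(2) i by simp
  obtain p where p: "awalk u' p v" "length p = card (differing u' v k)"
    using Suc.hyps(1)[OF n u' Suc.prems(2)] by blast
  have "{j. j < k \<and> u ! j \<noteq> u' ! j} = {i}"
    using len i by (auto simp: differing_def u'_def nth_list_update)
  then have "(u, u') \<in> parcs (hamming_graph m k)"
    using Suc.prems(1) u' by (simp add: hamming_graph_def)
  then have "awalk u ((u, u') # p) v"
    using p(1) by (simp add: awalk_Cons_iff)
  moreover have "length ((u, u') # p) = card (differing u v k)"
    using p(2) n Suc.hyps(2) by simp
  ultimately show ?case by blast
qed

text \<open>The distance is the least cost of a walk, and for unit weights the cost of a walk is its
  length.\<close>

lemma graph_dist_hamming_graph_le:
  assumes "u \<in> words m k" "v \<in> words m k"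
  shows "graph_dist (with_proj (hamming_graph m k)) u v \<le> ereal (real (card (differing u v k)))"
proof -
  interpret pair_graph "hamming_graph m k" by (rule pair_graph_hamming_graph)
  obtain p where p: "awalk u p v" "length p = card (differing u v k)"
    using awalk_hamming_graph[OF assms] by blast
  have "\<mu> (\<lambda>_. 1) u v \<le> ereal (awalk_cost (\<lambda>_. 1) p)"
    using p(1) by (rule min_cost_le_walk_cost)
  also have "awalk_cost (\<lambda>_. 1) p = real (card (differing u v k))"
    unfolding p(2)[symmetric] by (induction p) auto
  finally show ?thesis
    by (simp add: graph_dist_def)
qed

section \<open>Words, vectors and syndromes\<close>

lemma card_words: "card (words m k) = m ^ k"
proof -
  have "words m k = {w. set w \<subseteq> {1..m} \<and> length w = k}"
    by (auto simp: words_def)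
  then show ?thesis
    by (simp add: card_lists_length_eq)
qed

definition vectors :: "nat \<Rightarrow> nat \<Rightarrow> (nat \<Rightarrow> nat) set" where
  "vectors m s = PiE {..<s} (\<lambda>_. {..<m})"

text \<open>Vectors are extensional functions, \<open>undefined\<close> outside
  \<open>{..<s}\<close>, so the zero vector is the restricted constant function.\<close>

definition nonzero_vectors :: "nat \<Rightarrow> nat \<Rightarrow> (nat \<Rightarrow> nat) set" where
  "nonzero_vectors m s = vectors m s - {\<lambda>p\<in>{..<s}. 0}"

lemma finite_vectors: "finite (vectors m s)"
  by (auto simp: vectors_def intro: finite_PiE)

lemma finite_nonzero_vectors [simp]: "finite (nonzero_vectors m s)"
  by (simp add: nonzero_vectors_def finite_vectors)

lemma card_nonzero_vectors:
  assumes "m > 0"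
  shows "card (nonzero_vectors m s) = m ^ s - 1"
proof -
  have "(\<lambda>p\<in>{..<s}. 0) \<in> vectors m s"
    using assms by (auto simp: vectors_def)
  then show ?thesis
    using finite_vectors[of m s]
    by (simp add: nonzero_vectors_def card_Diff_singleton) (simp add: vectors_def card_PiE)
qed

text \<open>The map \<open>e\<close> sends a block number and a nonzero vector to the coordinate indexed by them.\<close>

definition syndrome ::
    "nat \<Rightarrow> nat \<Rightarrow> nat \<Rightarrow> (nat \<times> (nat \<Rightarrow> nat) \<Rightarrow> nat) \<Rightarrow> nat list \<Rightarrow> nat \<times> nat \<Rightarrow> nat" where
  "syndrome m s d e w =
    (\<lambda>(b, p)\<in>{..<d} \<times> {..<s}. (\<Sum>v\<in>nonzero_vectors m s. w ! e (b, v) * v p) mod m)"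

lemma syndrome_in_PiE:
  assumes "m > 0"
  shows "syndrome m s d e w \<in> PiE ({..<d} \<times> {..<s}) (\<lambda>_. {..<m})"
  using assms by (auto simp: syndrome_def)

lemma sum_mod_cong:
  fixes f g :: "'a \<Rightarrow> nat"
  assumes "\<And>a. a \<in> A \<Longrightarrow> f a mod m = g a mod m"
  shows "sum f A mod m = sum g A mod m"
proof -
  have "sum f A mod m = (\<Sum>a\<in>A. f a mod m) mod m"
    by (simp add: mod_sum_eq)
  also have "(\<Sum>a\<in>A. f a mod m) = (\<Sum>a\<in>A. g a mod m)"
    using assms by (intro sum.cong) auto
  finally show ?thesis
    by (simp add: mod_sum_eq)
qed

lemma exists_word_with_syndrome:
  assumes m: "m > 0"
    and e: "inj_on e ({..<d} \<times> nonzero_vectors m s)"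
    and ek: "e ` ({..<d} \<times> nonzero_vectors m s) \<subseteq> {..<k}"
    and t: "t \<in> PiE ({..<d} \<times> {..<s}) (\<lambda>_. {..<m})"
    and w: "w \<in> words m k"
  shows "\<exists>w'\<in>words m k. syndrome m s d e w' = t \<and> card (differing w w' k) \<le> d"
proof -
  define V where "V = nonzero_vectors m s"
  have finV: "finite V" by (simp add: V_def)
  define S where "S b p = (\<Sum>v\<in>V. w ! e (b, v) * v p)" for b p
  \<comment> \<open>The target minus the current syndrome of block \<open>b\<close>, modulo
    \<open>m\<close>. Adding \<open>m - S b p mod m\<close> avoids truncated subtraction.\<close>
  define r where "r b = (\<lambda>p\<in>{..<s}. (t (b, p) + (m - S b p mod m)) mod m)" for b
  \<comment> \<open>One letter per block is raised, at the coordinate indexed by \<open>r b\<close>;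
    a block with \<open>r b\<close> zero stays as it is. Letters run from 1 to \<open>m\<close>, so
    \<open>w ! i mod m + 1\<close> is the cyclic successor, sending \<open>m\<close> to 1.\<close>
  define w' where "w' = map (\<lambda>i. if \<exists>b<d. r b \<in> V \<and> i = e (b, r b) then w ! i mod m + 1 else w ! i) [0..<k]"
  have rV: "r b \<in> V \<or> r b = (\<lambda>p\<in>{..<s}. 0)" for b
    using m by (auto simp: V_def nonzero_vectors_def vectors_def r_def)
  have t_less: "t (b, p) < m" if "b < d" "p < s" for b p
    using that t by (auto simp: PiE_iff)
  have w'_words: "w' \<in> words m k"
  proof -
    have "w' ! i \<in> {1..m}" if "i < k" for i
    proof -
      have "w ! i \<in> {1..m}"
        using that w nth_mem[of i w] by (auto simp: words_def simp del: nth_mem)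
      moreover have "w ! i mod m + 1 \<in> {1..m}"
        using m by (simp add: Suc_leI)
      ultimately show ?thesis
        using that by (simp add: w'_def)
    qed
    then show ?thesis
      by (auto simp: words_def w'_def set_conv_nth)
  qed
  have letter: "w' ! e (b, v) mod m = (w ! e (b, v) + of_bool (v = r b)) mod m"
    if "b < d" "v \<in> V" for b v
  proof -
    have "e (b, v) < k"
      using that ek by (auto simp: V_def)
    \<comment> \<open>By injectivity of \<open>e\<close>, no other block and no other vector can
      cause a change at \<open>e (b, v)\<close>.\<close>
    moreover have "(\<exists>b'<d. r b' \<in> V \<and> e (b, v) = e (b', r b')) \<longleftrightarrow> v = r b"
      using that inj_onD[OF e, of "(b, v)"] by (auto simp: V_def)
    ultimately show ?thesis
      by (auto simp: w'_def mod_Suc_eq)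
  qed
  have "syndrome m s d e w' (b, p) = t (b, p)" if b: "b < d" and p: "p < s" for b p
  proof -
    have "syndrome m s d e w' (b, p) = (\<Sum>v\<in>V. w' ! e (b, v) * v p) mod m"
      using b p by (simp add: syndrome_def V_def)
    also have "\<dots> = (\<Sum>v\<in>V. (w ! e (b, v) + of_bool (v = r b)) * v p) mod m"
      by (rule sum_mod_cong) (intro mod_mult_cong letter[OF b] refl)
    also have "(\<Sum>v\<in>V. (w ! e (b, v) + of_bool (v = r b)) * v p)
        = S b p + (\<Sum>v\<in>V. of_bool (v = r b) * v p)"
      by (simp add: S_def algebra_simps sum.distrib)
    also have "(\<Sum>v\<in>V. of_bool (v = r b) * v p) = (\<Sum>v\<in>V. if v = r b then v p else 0)"
      by (intro sum.cong) auto
    \<comment> \<open>If \<open>r b\<close> lies outside \<open>V\<close>, the sum is 0, and so is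
      \<open>r b p\<close>, because \<open>r b\<close> is then the zero vector.\<close>
    also have "\<dots> = r b p"
      using rV[of b] p finV by (auto simp: sum.delta)
    also have "(S b p + r b p) mod m = (S b p mod m + (t (b, p) + (m - S b p mod m))) mod m"
      using p by (simp add: r_def mod_simps)
    also have "S b p mod m + (t (b, p) + (m - S b p mod m)) = t (b, p) + m"
      using mod_less_divisor[OF m, of "S b p"] by linarith
    also have "\<dots> mod m = t (b, p)"
      using t_less[OF b p] by simp
    finally show ?thesis .
  qed
  then have "syndrome m s d e w' = t"
    by (intro PiE_ext[OF syndrome_in_PiE[OF m] t]) auto
  moreover have "card (differing w w' k) \<le> d"
  proof -
    have "differing w w' k \<subseteq> (\<lambda>b. e (b, r b)) ` {..<d}"
      by (auto simp: differing_def w'_def split: if_splits)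
    then show ?thesis
      by (metis card_lessThan finite_lessThan surj_card_le)
  qed
  ultimately show ?thesis
    using w'_words by blast
qed

section \<open>A dominating set of the prescribed size\<close>

text \<open>The fibres partition \<open>A\<close>; if each were larger than the average, their sizes
  would add up to more than \<open>card A\<close>.\<close>

lemma exists_small_fibre:
  assumes A: "finite A" and T: "finite T" "T \<noteq> {}" and f: "f ` A \<subseteq> T"
  shows "\<exists>t\<in>T. card T * card {a \<in> A. f a = t} \<le> card A"
proof (rule ccontr)
  assume "\<not> ?thesis"
  then have "(\<Sum>t\<in>T. card A) < (\<Sum>t\<in>T. card T * card {a \<in> A. f a = t})"
    using T by (intro sum_strict_mono) auto
  also have "\<dots> = card T * card A"
    using sum.group[OF A T(1) f, of "\<lambda>_. 1 :: nat"] by (simp flip: sum_distrib_left)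
  finally show False by simp
qed

lemma distance_dominating_set_mono:
  assumes "distance_dominating_set G d C" "C \<subseteq> C'" "C' \<subseteq> verts G"
  shows "distance_dominating_set G d C'"
  using assms unfolding distance_dominating_set_def by blast

text \<open>The first bound on \<open>k\<close> makes room for \<open>d\<close> disjoint blocks of
  \<open>m ^ s - 1\<close> coordinates; the second keeps the exponent \<open>k - d * s\<close> from
  being truncated.\<close>

lemma exists_hamming_dominating_set:
  assumes m: "m > 0" and le: "d * (m ^ s - 1) \<le> k" and ds: "d * s \<le> k"
  shows "\<exists>C. distance_dominating_set (with_proj (hamming_graph m k)) d C \<and>
    card C = m ^ (k - d * s)"
proof -
  let ?I = "{..<d} \<times> nonzero_vectors m s"
  have "card ?I \<le> card {..<k}"
    using m le by (simp add: card_nonzero_vectors card_cartesian_product)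
  then obtain e where e: "inj_on e ?I" "e ` ?I \<subseteq> {..<k}"
    using card_le_inj[of ?I "{..<k}"] by auto
  define T where "T = PiE ({..<d} \<times> {..<s}) (\<lambda>_. {..<m})"
  have T: "finite T" "T \<noteq> {}" and cardT: "card T = m ^ (d * s)"
    using m by (auto simp: T_def card_PiE PiE_eq_empty_iff intro!: finite_PiE)
  obtain t where t: "t \<in> T"
    and small: "card T * card {w \<in> words m k. syndrome m s d e w = t} \<le> card (words m k)"
    using exists_small_fibre[OF finite_words T, of "syndrome m s d e" m k] syndrome_in_PiE[OF m]
    unfolding T_def by blast
  define C where "C = {w \<in> words m k. syndrome m s d e w = t}"
  have dom: "distance_dominating_set (with_proj (hamming_graph m k)) d C"
    unfolding distance_dominating_set_def
  proof (intro conjI ballI)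
    fix w assume "w \<in> verts (with_proj (hamming_graph m k))"
    then have w: "w \<in> words m k" by (simp add: hamming_graph_def)
    obtain w' where w': "w' \<in> words m k" "syndrome m s d e w' = t" "card (differing w w' k) \<le> d"
      using exists_word_with_syndrome[OF m e t[unfolded T_def] w] by blast
    have "graph_dist (with_proj (hamming_graph m k)) w w' \<le> ereal (real (card (differing w w' k)))"
      by (rule graph_dist_hamming_graph_le[OF w w'(1)])
    also have "\<dots> \<le> ereal (real d)"
      using w'(3) by simp
    finally show "\<exists>c\<in>C. graph_dist (with_proj (hamming_graph m k)) w c \<le> ereal (real d)"
      using w' by (auto simp: C_def)
  qed (auto simp: C_def hamming_graph_def)
  have "card C \<le> m ^ (k - d * s)"
  proof -
    have "m ^ (d * s) * card C \<le> m ^ (d * s) * m ^ (k - d * s)"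
      using small ds by (simp add: C_def cardT card_words flip: power_add)
    then show ?thesis
      using m by simp
  qed
  \<comment> \<open>The fibre may be too small; enlarging it to the exact size within
    \<open>words m k\<close> preserves domination.\<close>
  moreover have "m ^ (k - d * s) \<le> card (words m k)"
    using m by (simp add: card_words power_increasing)
  moreover have "C \<subseteq> words m k" by (auto simp: C_def)
  ultimately obtain C' where "C \<subseteq> C'" "C' \<subseteq> words m k" "card C' = m ^ (k - d * s)"
    using exists_subset_between[OF _ _ _ finite_words] by metis
  moreover have "words m k = verts (with_proj (hamming_graph m k))"
    by (simp add: hamming_graph_def)
  ultimately show ?thesis
    using dom distance_dominating_set_mono by metis
qed

theorem theorem2p1:
  fixes m k d :: nat
  assumes "m \<ge> 2" and "k \<ge> 1" and "d \<ge> 1"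
  shows "\<exists>C. distance_dominating_set (with_proj (hamming_graph m k)) d C \<and>
    real (card C) = real m powi (int k - int d * \<lfloor>log (real m) (real k / real d + 1)\<rfloor>) \<and>
    real m powi (int k - int d * \<lfloor>log (real m) (real k / real d + 1)\<rfloor>)
      < real d ^ d * real m ^ (k + d) / real (k + d) ^ d"
proof -
  define x where "x = real k / real d + 1"
  have m: "real m > 1" and d: "real d > 0" and x: "x > 1"
    using assms by (auto simp: x_def)
  define s where "s = nat \<lfloor>log (real m) x\<rfloor>"
  have "log (real m) x \<ge> 0"
    using m x by simp
  then have s: "\<lfloor>log (real m) x\<rfloor> = int s"
    by (simp add: s_def)
  \<comment> \<open>The floor gives \<open>m ^ s \<le> x < m ^ (s + 1)\<close>: the lower half makes
    the blocks fit, the upper half yields the strict inequality.\<close>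
  have "real s \<le> log (real m) x" "log (real m) x < real (s + 1)"
    using s by linarith+
  then have lower: "real m ^ s \<le> x" and upper: "x < real m ^ (s + 1)"
    using m x by (simp_all only: le_log_iff log_less_iff less_trans[OF zero_less_one] powr_realpow)
  have "real (d * m ^ s) \<le> real (k + d)"
    using lower d by (simp add: x_def field_simps)
  then have "d * m ^ s \<le> k + d"
    by linarith
  then have le: "d * (m ^ s - 1) \<le> k"
    by (simp add: diff_mult_distrib2)
  \<comment> \<open>From \<open>s < 2 ^ s \<le> m ^ s\<close>. Hence \<open>d * s \<le> k\<close>,
    so the integer exponent is nonnegative and \<open>powi\<close> becomes an ordinary
    power.\<close>
  have "s \<le> m ^ s - 1"
    using less_exp[of s] power_mono[of 2 m s] assms(1) by linarith
  then have ds: "d * s \<le> k"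
    using le by (meson le_trans mult_le_mono2)
  have powi: "real m powi (int k - int d * int s) = real m ^ (k - d * s)"
    using ds by (simp flip: of_nat_mult of_nat_diff)
  have "real (k + d) / real d < real m ^ (s + 1)"
    using upper d by (simp add: x_def add_divide_distrib)
  \<comment> \<open>Strictness survives the power because \<open>d\<close> is positive; multiplying
    by \<open>m ^ (k - d * s)\<close> then turns the exponent \<open>d * s + d\<close> into
    \<open>k + d\<close>.\<close>
  then have "(real (k + d) / real d) ^ d < (real m ^ (s + 1)) ^ d"
    using assms by (intro power_strict_mono) auto
  also have "\<dots> = real m ^ (d * s + d)"
    by (simp only: power_mult[symmetric]) (simp add: algebra_simps)
  finally have "real (k + d) ^ d < real d ^ d * real m ^ (d * s + d)"
    using d by (simp add: power_divide field_simps)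
  then have "real m ^ (k - d * s) * real (k + d) ^ d
      < real m ^ (k - d * s) * (real d ^ d * real m ^ (d * s + d))"
    using m by simp
  also have "\<dots> = real d ^ d * real m ^ (k - d * s + (d * s + d))"
    by (simp add: power_add)
  also have "k - d * s + (d * s + d) = k + d"
    using ds by simp
  finally have "real m ^ (k - d * s) < real d ^ d * real m ^ (k + d) / real (k + d) ^ d"
    using d by (simp add: pos_less_divide_eq)
  moreover obtain C where "distance_dominating_set (with_proj (hamming_graph m k)) d C"
      "card C = m ^ (k - d * s)"
    using exists_hamming_dominating_set[OF _ le ds] assms(1) by auto
  ultimately show ?thesis
    unfolding x_def[symmetric] s powi by auto
qed

end
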